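(* Let $R$ be a commutative, associative, unital ring. Then $R$ is a right $V$-ring if and only if every simple $R$-module is strongly $\text{Red}$-injective.
   Context: All modules are unital right $R$-modules. An $R$-module $M$ is reduced if for all $r\in R$ and $m\in M$, $mr^{2}=0$ implies $mr=0$; a submodule is reduced if it is reduced as a module. $\text{Red}(M)$ denotes the sum of all reduced submodules of $M$. A module $M$ is semi-reduced if $\text{Red}(M)=M$; a submodule is semi-reduced if it is so as a module. For $R$-modules $M$ and $N$, $M$ is $\text{Red}$-$N$-injective if for every semi-reduced submodule $K$ of $N$, every $R$-homomorphism $f:K\rightarrow M$ extends to an $R$-homomorphism $N\rightarrow M$. $M$ is strongly $\text{Red}$-injective if $M$ is $\text{Red}$-$N$-injective for all $R$-modules $N$. A right $V$-ring is a ring all of whose simple right modules are injective. *)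

theory Defs
  imports "HOL-Algebra.Module"
begin

text \<open>
  The base ring is commutative throughout (\<^locale>\<open>module\<close> requires \<^locale>\<open>cring\<close>), so left and
  right modules coincide, and the right action of \<open>r\<close> on \<open>m\<close> is written \<open>r \<odot> m\<close>.

  A quantifier over all modules cannot range over types. Notions that test a module against all
  modules therefore take a type argument \<open>'n itself\<close>: the test modules are all modules whose
  carrier is a set of elements of \<open>'n\<close>. Since \<open>'n\<close> is left as a type variable, it plays the
  role of an arbitrary universe.
\<close>

definition module_hom ::
    "('a, 'x) ring_scheme \<Rightarrow> ('a, 'b) module \<Rightarrow> ('a, 'c) module \<Rightarrow> ('b \<Rightarrow> 'c) set" where
  "module_hom R M N =
     {f \<in> carrier M \<rightarrow> carrier N.
        (\<forall>x\<in>carrier M. \<forall>y\<in>carrier M. f (x \<oplus>\<^bsub>M\<^esub> y) = f x \<oplus>\<^bsub>N\<^esub> f y) \<and>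
        (\<forall>r\<in>carrier R. \<forall>x\<in>carrier M. f (r \<odot>\<^bsub>M\<^esub> x) = r \<odot>\<^bsub>N\<^esub> f x)}"

definition simple_module :: "('a, 'x) ring_scheme \<Rightarrow> ('a, 'b) module \<Rightarrow> bool" where
  "simple_module R M \<longleftrightarrow>
     module R M \<and> carrier M \<noteq> {\<zero>\<^bsub>M\<^esub>} \<and>
     (\<forall>K. submodule K R M \<longrightarrow> K = {\<zero>\<^bsub>M\<^esub>} \<or> K = carrier M)"

definition reduced_module :: "('a, 'x) ring_scheme \<Rightarrow> ('a, 'b) module \<Rightarrow> bool" where
  "reduced_module R M \<longleftrightarrow>
     module R M \<and>
     (\<forall>r\<in>carrier R. \<forall>m\<in>carrier M.
        (r [^]\<^bsub>R\<^esub> (2::nat)) \<odot>\<^bsub>M\<^esub> m = \<zero>\<^bsub>M\<^esub> \<longrightarrow> r \<odot>\<^bsub>M\<^esub> m = \<zero>\<^bsub>M\<^esub>)"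

definition sum_of_submodules :: "('a, 'b) module \<Rightarrow> 'b set set \<Rightarrow> 'b set" where
  "sum_of_submodules M \<F> =
     {finsum M f I | f I. finite I \<and> I \<subseteq> \<F> \<and> (\<forall>K\<in>I. f K \<in> K)}"

definition Red :: "('a, 'x) ring_scheme \<Rightarrow> ('a, 'b) module \<Rightarrow> 'b set" where
  "Red R M =
     sum_of_submodules M {K. submodule K R M \<and> reduced_module R (M\<lparr>carrier := K\<rparr>)}"

definition semi_reduced_module :: "('a, 'x) ring_scheme \<Rightarrow> ('a, 'b) module \<Rightarrow> bool" where
  "semi_reduced_module R M \<longleftrightarrow> module R M \<and> Red R M = carrier M"

text \<open>\<open>Red_injective_wrt R N M\<close>: the module \<open>M\<close> is Red-\<open>N\<close>-injective.\<close>

definition Red_injective_wrt ::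
    "('a, 'x) ring_scheme \<Rightarrow> ('a, 'n) module \<Rightarrow> ('a, 'b) module \<Rightarrow> bool" where
  "Red_injective_wrt R N M \<longleftrightarrow>
     (\<forall>K. submodule K R N \<and> semi_reduced_module R (N\<lparr>carrier := K\<rparr>) \<longrightarrow>
        (\<forall>f\<in>module_hom R (N\<lparr>carrier := K\<rparr>) M.
           \<exists>g\<in>module_hom R N M. \<forall>x\<in>K. g x = f x))"

definition strongly_Red_injective ::
    "'n itself \<Rightarrow> ('a, 'x) ring_scheme \<Rightarrow> ('a, 'b) module \<Rightarrow> bool" where
  "strongly_Red_injective _ R M \<longleftrightarrow>
     module R M \<and> (\<forall>N :: ('a, 'n) module. module R N \<longrightarrow> Red_injective_wrt R N M)"

definition injective_module ::
    "'n itself \<Rightarrow> ('a, 'x) ring_scheme \<Rightarrow> ('a, 'b) module \<Rightarrow> bool" where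
  "injective_module _ R M \<longleftrightarrow>
     module R M \<and>
     (\<forall>(A :: ('a, 'n) module) (B :: ('a, 'n) module). module R A \<and> module R B \<longrightarrow>
        (\<forall>i\<in>module_hom R A B. inj_on i (carrier A) \<longrightarrow>
           (\<forall>f\<in>module_hom R A M. \<exists>g\<in>module_hom R B M. \<forall>x\<in>carrier A. g (i x) = f x)))"

text \<open>Simple modules have their carrier in \<open>'s\<close>, test modules for injectivity in \<open>'n\<close>.\<close>

definition V_ring :: "'s itself \<Rightarrow> 'n itself \<Rightarrow> ('a, 'x) ring_scheme \<Rightarrow> bool" where
  "V_ring _ n R \<longleftrightarrow>
     cring R \<and> (\<forall>S :: ('a, 's) module. simple_module R S \<longrightarrow> injective_module n R S)"

end

theory Submission
  imports Defs
begin

text \<open>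
  A simple module \<open>S\<close> over a commutative ring is reduced, because the annihilator in \<open>S\<close> of a ring
  element is a submodule. So to extend \<open>f : A \<rightarrow> S\<close> along an embedding \<open>i : A \<rightarrow> B\<close>, divide
  \<open>B\<close> by \<open>i(ker f)\<close>: the image of \<open>A\<close> in the quotient embeds into \<open>S\<close>, hence is reduced, and
  Red-injectivity of \<open>S\<close> extends the induced map from there to the whole quotient.
\<close>

section \<open>Module homomorphisms, images and kernels\<close>

lemma (in abelian_group) minus_eq_zero_iff:
  assumes "x \<in> carrier G" "y \<in> carrier G"
  shows "x \<ominus> y = \<zero> \<longleftrightarrow> x = y"
  using assms add.inv_solve_right'[of \<zero> x y] by (auto simp: a_minus_def)

lemma module_homD:
  assumes "f \<in> module_hom R M N"
  shows "x \<in> carrier M \<Longrightarrow> f x \<in> carrier N"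
    and "x \<in> carrier M \<Longrightarrow> y \<in> carrier M \<Longrightarrow> f (x \<oplus>\<^bsub>M\<^esub> y) = f x \<oplus>\<^bsub>N\<^esub> f y"
    and "r \<in> carrier R \<Longrightarrow> x \<in> carrier M \<Longrightarrow> f (r \<odot>\<^bsub>M\<^esub> x) = r \<odot>\<^bsub>N\<^esub> f x"
  using assms by (auto simp: module_hom_def)

lemma module_homI:
  assumes "\<And>x. x \<in> carrier M \<Longrightarrow> f x \<in> carrier N"
    and "\<And>x y. x \<in> carrier M \<Longrightarrow> y \<in> carrier M \<Longrightarrow> f (x \<oplus>\<^bsub>M\<^esub> y) = f x \<oplus>\<^bsub>N\<^esub> f y"
    and "\<And>r x. r \<in> carrier R \<Longrightarrow> x \<in> carrier M \<Longrightarrow> f (r \<odot>\<^bsub>M\<^esub> x) = r \<odot>\<^bsub>N\<^esub> f x"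
  shows "f \<in> module_hom R M N"
  using assms by (auto simp: module_hom_def)

lemma module_hom_compose:
  assumes "f \<in> module_hom R L M" "g \<in> module_hom R M N"
  shows "(\<lambda>x. g (f x)) \<in> module_hom R L N"
  using assms by (auto simp: module_hom_def Pi_iff)

lemma module_hom_zero:
  assumes "module R M" "module R N" "f \<in> module_hom R M N"
  shows "f \<zero>\<^bsub>M\<^esub> = \<zero>\<^bsub>N\<^esub>"
proof -
  interpret M: module R M by fact
  interpret N: module R N by fact
  \<comment> \<open>Writing zero as a scalar multiple by zero reduces the claim to compatibility of
    \<open>f\<close> with scalars.\<close>
  have "f (\<zero>\<^bsub>R\<^esub> \<odot>\<^bsub>M\<^esub> \<zero>\<^bsub>M\<^esub>) = \<zero>\<^bsub>R\<^esub> \<odot>\<^bsub>N\<^esub> f \<zero>\<^bsub>M\<^esub>"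
    using module_homD[OF assms(3)] by blast
  then show ?thesis
    using module_homD(1)[OF assms(3)] by simp
qed

lemma module_hom_a_inv:
  assumes "module R M" "module R N" "f \<in> module_hom R M N" "x \<in> carrier M"
  shows "f (\<ominus>\<^bsub>M\<^esub> x) = \<ominus>\<^bsub>N\<^esub> f x"
proof -
  interpret M: module R M by fact
  interpret N: module R N by fact
  have "f (\<ominus>\<^bsub>M\<^esub> x) \<oplus>\<^bsub>N\<^esub> f x = \<zero>\<^bsub>N\<^esub>"
    using module_homD(2)[OF assms(3), of "\<ominus>\<^bsub>M\<^esub> x" x] assms(4)
      module_hom_zero[OF assms(1-3)] by (simp add: M.M.l_neg)
  then show ?thesis
    using module_homD(1)[OF assms(3)] assms(4) by (simp add: N.M.minus_equality)
qed

lemma module_hom_minus: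
  assumes "module R M" "module R N" "f \<in> module_hom R M N" "x \<in> carrier M" "y \<in> carrier M"
  shows "f (x \<ominus>\<^bsub>M\<^esub> y) = f x \<ominus>\<^bsub>N\<^esub> f y"
proof -
  interpret M: module R M by fact
  show ?thesis
    using module_homD(2)[OF assms(3)] module_hom_a_inv[OF assms(1-3)] assms(4,5)
    by (simp add: a_minus_def)
qed

text \<open>Needed twice: for the image in \<open>B\<close> of the kernel of \<open>f\<close>, and
  for the image of \<open>A\<close> in the quotient.\<close>

lemma submodule_image:
  assumes "module R M" "module R N" "f \<in> module_hom R M N" "submodule H R M"
  shows "submodule (f ` H) R N"
proof -
  interpret M: module R M by fact
  interpret N: module R N by fact
  note H = M.submoduleE[OF assms(4)]
  have sub: "x \<in> carrier M" if "x \<in> H" for x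
    using H(1) that by blast
  have zero: "\<zero>\<^bsub>M\<^esub> \<in> H"
    using subgroup.one_closed[OF submodule.axioms(1)[OF assms(4)]] by simp
  show ?thesis
  proof (rule N.submoduleI)
    show "f ` H \<subseteq> carrier N"
      using module_homD(1)[OF assms(3)] sub by blast
    show "\<zero>\<^bsub>N\<^esub> \<in> f ` H"
      using module_hom_zero[OF assms(1-3)] zero by (metis imageI)
    show "\<ominus>\<^bsub>N\<^esub> a \<in> f ` H" if "a \<in> f ` H" for a
      using that H(3) sub by (auto simp flip: module_hom_a_inv[OF assms(1-3)])
    show "a \<oplus>\<^bsub>N\<^esub> b \<in> f ` H" if "a \<in> f ` H" "b \<in> f ` H" for a b
      using that H(5) sub by (auto simp flip: module_homD(2)[OF assms(3)])
    show "a \<odot>\<^bsub>N\<^esub> x \<in> f ` H" if "a \<in> carrier R" "x \<in> f ` H" for a x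
      using that H(4) sub by (auto simp flip: module_homD(3)[OF assms(3)])
  qed
qed

lemma submodule_kernel:
  assumes "module R M" "module R N" "f \<in> module_hom R M N"
  shows "submodule {x \<in> carrier M. f x = \<zero>\<^bsub>N\<^esub>} R M"
proof -
  interpret M: module R M by fact
  interpret N: module R N by fact
  show ?thesis
    by (rule M.submoduleI)
      (auto simp: module_hom_zero[OF assms] module_hom_a_inv[OF assms] module_homD[OF assms(3)])
qed

section \<open>Reduced and semi-reduced modules\<close>

lemma simple_imp_reduced_module:
  assumes "simple_module R S"
  shows "reduced_module R S"
proof -
  interpret S: module R S using assms by (simp add: simple_module_def)
  have "r \<odot>\<^bsub>S\<^esub> m = \<zero>\<^bsub>S\<^esub>"
    if r: "r \<in> carrier R" and m: "m \<in> carrier S"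
      and eq: "(r [^]\<^bsub>R\<^esub> (2::nat)) \<odot>\<^bsub>S\<^esub> m = \<zero>\<^bsub>S\<^esub>" for r m
  proof -
    let ?K = "{x \<in> carrier S. r \<odot>\<^bsub>S\<^esub> x = \<zero>\<^bsub>S\<^esub>}"
    \<comment> \<open>Commutativity of \<open>R\<close> makes multiplication by \<open>r\<close>
      linear, so \<open>?K\<close> is a kernel. It contains \<open>r\<close> times \<open>m\<close>:
      if \<open>?K\<close> is zero, this element vanishes; if \<open>?K\<close> is everything,
      \<open>m\<close> itself lies in it.\<close>
    have "(\<lambda>x. r \<odot>\<^bsub>S\<^esub> x) \<in> module_hom R S S"
      using r by (auto intro!: module_homI simp: S.smult_r_distr S.R.m_comm
          simp flip: S.smult_assoc1)
    then have "submodule ?K R S"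
      using S.module_axioms by (intro submodule_kernel)
    then have "?K = {\<zero>\<^bsub>S\<^esub>} \<or> ?K = carrier S"
      using assms by (simp add: simple_module_def)
    moreover have "r \<odot>\<^bsub>S\<^esub> m \<in> ?K"
      using r m eq by (simp add: numeral_2_eq_2 S.smult_assoc1)
    ultimately show ?thesis
      using m by blast
  qed
  then show ?thesis
    by (simp add: reduced_module_def S.module_axioms)
qed

text \<open>The whole carrier is one of the reduced submodules being summed, so every element is a
  one-term sum. Sums are indexed by the submodules themselves, hence the index set
  \<open>{carrier M}\<close>.\<close>

lemma reduced_imp_semi_reduced_module:
  assumes "reduced_module R M"
  shows "semi_reduced_module R M"
proof -
  interpret M: module R M using assms by (simp add: reduced_module_def)
  have "x \<in> Red R M" if "x \<in> carrier M" for x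
  proof -
    have "finsum M (\<lambda>_. x) {carrier M} = x"
      using that by simp
    moreover have "submodule (carrier M) R M \<and> reduced_module R (M\<lparr>carrier := carrier M\<rparr>)"
      using M.carrier_is_submodule assms by simp
    ultimately show ?thesis
      unfolding Red_def sum_of_submodules_def using that
      by (intro CollectI exI[of _ "\<lambda>_. x"] exI[of _ "{carrier M}"]) auto
  qed
  moreover have "Red R M \<subseteq> carrier M"
    unfolding Red_def sum_of_submodules_def
    by (auto intro!: M.M.finsum_closed dest!: M.submoduleE(1))
  ultimately show ?thesis
    by (auto simp: semi_reduced_module_def M.module_axioms)
qed

text \<open>If the square of \<open>r\<close> kills \<open>m\<close>, it kills \<open>f m\<close>,
  so \<open>r\<close> kills \<open>f m\<close>; injectivity pulls this back to
  \<open>m\<close>.\<close>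

lemma reduced_module_embedding:
  assumes "module R M" "reduced_module R N" "f \<in> module_hom R M N" "inj_on f (carrier M)"
  shows "reduced_module R M"
proof -
  interpret M: module R M by fact
  have N: "module R N" using assms(2) by (simp add: reduced_module_def)
  have iff: "f x = \<zero>\<^bsub>N\<^esub> \<longleftrightarrow> x = \<zero>\<^bsub>M\<^esub>" if "x \<in> carrier M" for x
    using that module_hom_zero[OF assms(1) N assms(3)] inj_onD[OF assms(4), of x "\<zero>\<^bsub>M\<^esub>"] by auto
  have "r \<odot>\<^bsub>M\<^esub> m = \<zero>\<^bsub>M\<^esub>"
    if "r \<in> carrier R" "m \<in> carrier M" "(r [^]\<^bsub>R\<^esub> (2::nat)) \<odot>\<^bsub>M\<^esub> m = \<zero>\<^bsub>M\<^esub>" for r m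
    using that assms(2) module_homD(1,3)[OF assms(3)] iff
    by (metis M.R.nat_pow_closed M.smult_closed reduced_module_def)
  then show ?thesis
    by (simp add: reduced_module_def assms(1))
qed

text \<open>
  The carrier of the quotient consists of chosen coset representatives rather than of cosets,
  so that it stays inside the type of \<open>M\<close> and remains an admissible test module.
\<close>

lemma quotient_module_exists:
  fixes M :: "('a, 'n) module"
  assumes "module R M" "submodule L R M"
  obtains Q :: "('a, 'n) module" and p
  where "module R Q" "p \<in> module_hom R M Q" "p ` carrier M = carrier Q"
    and "\<And>x. x \<in> carrier M \<Longrightarrow> p x = \<zero>\<^bsub>Q\<^esub> \<longleftrightarrow> x \<in> L"
proof -
  interpret M: module R M by fact
  note L = M.submoduleE[OF assms(2)]
  have zero: "\<zero>\<^bsub>M\<^esub> \<in> L"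
    using subgroup.one_closed[OF submodule.axioms(1)[OF assms(2)]] by simp
  have LM: "x \<in> carrier M" if "x \<in> L" for x
    using L(1) that by blast
  \<comment> \<open>Congruence modulo \<open>L\<close>, with membership in the carrier built
    in.\<close>
  define cong where "cong x y \<longleftrightarrow> x \<in> carrier M \<and> y \<in> carrier M \<and> x \<ominus>\<^bsub>M\<^esub> y \<in> L" for x y
  have refl: "cong x x" if "x \<in> carrier M" for x
    using that zero by (simp add: cong_def a_minus_def M.M.r_neg)
  have sym: "cong y x" if "cong x y" for x y
  proof -
    have "y \<ominus>\<^bsub>M\<^esub> x = \<ominus>\<^bsub>M\<^esub> (x \<ominus>\<^bsub>M\<^esub> y)"
      using that by (simp add: cong_def a_minus_def M.M.minus_add M.M.a_comm)
    then show ?thesis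
      using that L(3) by (simp add: cong_def)
  qed
  have add: "cong (x \<oplus>\<^bsub>M\<^esub> x') (y \<oplus>\<^bsub>M\<^esub> y')" if "cong x y" "cong x' y'" for x y x' y'
  proof -
    have "(x \<oplus>\<^bsub>M\<^esub> x') \<ominus>\<^bsub>M\<^esub> (y \<oplus>\<^bsub>M\<^esub> y') = (x \<ominus>\<^bsub>M\<^esub> y) \<oplus>\<^bsub>M\<^esub> (x' \<ominus>\<^bsub>M\<^esub> y')"
      using that by (simp add: cong_def a_minus_def M.M.minus_add M.M.a_ac)
    then show ?thesis
      using that L(5) by (simp add: cong_def)
  qed
  have trans: "cong x z" if "cong x y" "cong y z" for x y z
  proof -
    have "x \<ominus>\<^bsub>M\<^esub> z = (x \<ominus>\<^bsub>M\<^esub> y) \<oplus>\<^bsub>M\<^esub> (y \<ominus>\<^bsub>M\<^esub> z)"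
      using that by (simp add: cong_def a_minus_def M.M.a_assoc M.M.r_neg1)
    then show ?thesis
      using that L(5) by (simp add: cong_def)
  qed
  have smult: "cong (r \<odot>\<^bsub>M\<^esub> x) (r \<odot>\<^bsub>M\<^esub> y)" if "r \<in> carrier R" "cong x y" for r x y
  proof -
    have "r \<odot>\<^bsub>M\<^esub> x \<ominus>\<^bsub>M\<^esub> r \<odot>\<^bsub>M\<^esub> y = r \<odot>\<^bsub>M\<^esub> (x \<ominus>\<^bsub>M\<^esub> y)"
      using that by (simp add: cong_def a_minus_def M.smult_r_distr M.smult_r_minus)
    then show ?thesis
      using that L(4) by (simp add: cong_def)
  qed
  \<comment> \<open>\<open>p\<close> selects one representative from each coset. Congruent elements
    have the same coset, so \<open>SOME\<close> is applied to the same predicate and yields the same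
    element.\<close>
  define p where "p x = (SOME y. cong y x)" for x
  have p: "cong (p x) x" if "x \<in> carrier M" for x
    unfolding p_def using refl[OF that] by (rule someI)
  have p_eqI: "p x = p y" if "cong x y" for x y
  proof -
    have "cong z x \<longleftrightarrow> cong z y" for z
      using that trans sym by blast
    then show ?thesis by (simp add: p_def)
  qed
  have p_eqD: "cong x y" if "p x = p y" "x \<in> carrier M" "y \<in> carrier M" for x y
    using p[OF that(2)] p[OF that(3)] that(1) trans sym by metis
  have p_closed [simp]: "p x \<in> carrier M" if "x \<in> carrier M" for x
    using p[OF that] by (simp add: cong_def)
  \<comment> \<open>Each operation is computed in \<open>M\<close> and its result is replaced by its
    representative.\<close>
  define Q :: "('a, 'n) module" where
    "Q = \<lparr>carrier = p ` carrier M, mult = (\<lambda>x y. x), one = \<zero>\<^bsub>M\<^esub>, zero = p \<zero>\<^bsub>M\<^esub>,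
          add = (\<lambda>x y. p (x \<oplus>\<^bsub>M\<^esub> y)), smult = (\<lambda>r x. p (r \<odot>\<^bsub>M\<^esub> x))\<rparr>"
  \<comment> \<open>Replacing arguments by their representatives does not change the coset of the
    result. Hence the module laws of \<open>Q\<close> are images under \<open>p\<close> of those of
    \<open>M\<close>.\<close>
  have p_add: "p x \<oplus>\<^bsub>Q\<^esub> p y = p (x \<oplus>\<^bsub>M\<^esub> y)" if "x \<in> carrier M" "y \<in> carrier M" for x y
    unfolding Q_def using that by (simp add: p_eqI add p)
  have p_smult: "r \<odot>\<^bsub>Q\<^esub> p x = p (r \<odot>\<^bsub>M\<^esub> x)" if "r \<in> carrier R" "x \<in> carrier M" for r x
    unfolding Q_def using that by (simp add: p_eqI smult p)
  have p_zero: "\<zero>\<^bsub>Q\<^esub> = p \<zero>\<^bsub>M\<^esub>" and carrier: "carrier Q = p ` carrier M"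
    by (simp_all add: Q_def)
  have neg: "\<exists>y\<in>carrier M. p (x \<oplus>\<^bsub>M\<^esub> y) = p \<zero>\<^bsub>M\<^esub>" if "x \<in> carrier M" for x
    using that by (intro bexI[of _ "\<ominus>\<^bsub>M\<^esub> x"]) (simp_all add: M.M.r_neg)
  have "abelian_group Q"
    by (rule abelian_groupI)
      (auto simp: carrier p_zero p_add M.M.a_ac neg)
  then have "module R Q"
    by (rule moduleI[OF M.R.cring_axioms])
      (auto simp: carrier p_add p_smult M.smult_l_distr M.smult_r_distr M.smult_assoc1)
  moreover have "p \<in> module_hom R M Q"
    by (rule module_homI) (auto simp: carrier p_add p_smult)
  moreover have "p x = \<zero>\<^bsub>Q\<^esub> \<longleftrightarrow> x \<in> L" if "x \<in> carrier M" for x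
  proof -
    have neg_zero: "\<ominus>\<^bsub>M\<^esub> \<zero>\<^bsub>M\<^esub> = \<zero>\<^bsub>M\<^esub>"
      by (rule M.M.minus_equality) simp_all
    have "p x = \<zero>\<^bsub>Q\<^esub> \<longleftrightarrow> cong x \<zero>\<^bsub>M\<^esub>"
      using p_eqI p_eqD[OF _ that M.M.zero_closed] unfolding p_zero by blast
    also have "\<dots> \<longleftrightarrow> x \<in> L"
      using that by (simp add: cong_def a_minus_def neg_zero)
    finally show ?thesis .
  qed
  ultimately show thesis
    using that[OF _ _ carrier[symmetric]] by blast
qed

section \<open>Injectivity and strong Red-injectivity\<close>

lemma injective_imp_strongly_Red_injective:
  assumes "injective_module TYPE('n) R S"
  shows "strongly_Red_injective TYPE('n) R S"
proof -
  have "\<exists>g\<in>module_hom R N S. \<forall>x\<in>K. g x = f x"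
    if N: "module R N" and K: "submodule K R N" and f: "f \<in> module_hom R (N\<lparr>carrier := K\<rparr>) S"
    for N :: "('a, 'n) module" and K f
  proof -
    have "K \<subseteq> carrier N"
      using module.submoduleE(1)[OF N K] .
    \<comment> \<open>The inclusion of \<open>K\<close> into \<open>N\<close> is the embedding to
      which injectivity is applied.\<close>
    then have "(\<lambda>x. x) \<in> module_hom R (N\<lparr>carrier := K\<rparr>) N"
      by (auto intro!: module_homI)
    moreover have "module R (N\<lparr>carrier := K\<rparr>)"
      using submodule.submodule_is_module[OF K N] .
    ultimately have "\<exists>g\<in>module_hom R N S. \<forall>x\<in>carrier (N\<lparr>carrier := K\<rparr>). g x = f x"
      using assms N f unfolding injective_module_def by (metis inj_on_id2)
    then show ?thesis by simp
  qed
  then show ?thesis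
    using assms
    by (auto simp: strongly_Red_injective_def Red_injective_wrt_def injective_module_def)
qed

text \<open>Reducedness of \<open>S\<close> is what makes the image of \<open>A\<close> in the
  quotient semi-reduced, so that Red-injectivity can be applied there.\<close>

lemma reduced_strongly_Red_injective_imp_injective:
  assumes red: "reduced_module R S" and inj: "strongly_Red_injective TYPE('n) R S"
  shows "injective_module TYPE('n) R S"
proof -
  interpret S: module R S using red by (simp add: reduced_module_def)
  have "\<exists>g\<in>module_hom R B S. \<forall>x\<in>carrier A. g (i x) = f x"
    if A: "module R A" and B: "module R B" and i: "i \<in> module_hom R A B"
      and i_inj: "inj_on i (carrier A)" and f: "f \<in> module_hom R A S"
    for A B :: "('a, 'n) module" and i f
  proof -
    interpret A: module R A by fact
    interpret B: module R B by fact
    \<comment> \<open>Dividing by \<open>L\<close> makes the composite \<open>A\<close> to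
      \<open>B\<close> to the quotient kill exactly what \<open>f\<close> kills.\<close>
    define L where "L = i ` {x \<in> carrier A. f x = \<zero>\<^bsub>S\<^esub>}"
    have "submodule L R B"
      unfolding L_def using submodule_image[OF A B i submodule_kernel[OF A S.module_axioms f]] .
    then obtain Q :: "('a, 'n) module" and p where Q: "module R Q" and p: "p \<in> module_hom R B Q"
      and ker_p: "\<And>x. x \<in> carrier B \<Longrightarrow> p x = \<zero>\<^bsub>Q\<^esub> \<longleftrightarrow> x \<in> L"
      using quotient_module_exists[OF B] by metis
    interpret Q: module R Q by fact
    define q where "q = (\<lambda>x. p (i x))"
    have q: "q \<in> module_hom R A Q"
      unfolding q_def using module_hom_compose[OF i p] .
    note q_simps = module_homD[OF q] and f_simps = module_homD[OF f]
    have ker_q: "q x = \<zero>\<^bsub>Q\<^esub> \<longleftrightarrow> f x = \<zero>\<^bsub>S\<^esub>" if "x \<in> carrier A" for x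
    proof -
      have "q x = \<zero>\<^bsub>Q\<^esub> \<longleftrightarrow> i x \<in> L"
        using ker_p module_homD(1)[OF i that] by (simp add: q_def)
      \<comment> \<open>If \<open>i x\<close> equals \<open>i x'\<close> with \<open>x'\<close> in
        the kernel of \<open>f\<close>, injectivity of \<open>i\<close> gives
        \<open>x = x'\<close>.\<close>
      also have "\<dots> \<longleftrightarrow> f x = \<zero>\<^bsub>S\<^esub>"
        using that i_inj by (auto simp: L_def dest: inj_onD)
      finally show ?thesis .
    qed
    \<comment> \<open>Equal kernels mean that \<open>q\<close> and \<open>f\<close> identify the
      same pairs. One direction makes the induced map \<open>h\<close> well defined, the other makes
      it injective.\<close>
    have q_eq_iff: "q x = q y \<longleftrightarrow> f x = f y" if "x \<in> carrier A" "y \<in> carrier A" for x y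
    proof -
      have "q x = q y \<longleftrightarrow> q (x \<ominus>\<^bsub>A\<^esub> y) = \<zero>\<^bsub>Q\<^esub>"
        using that q_simps(1) by (simp add: module_hom_minus[OF A Q q] Q.M.minus_eq_zero_iff)
      also have "\<dots> \<longleftrightarrow> f (x \<ominus>\<^bsub>A\<^esub> y) = \<zero>\<^bsub>S\<^esub>"
        using that by (simp add: ker_q)
      also have "\<dots> \<longleftrightarrow> f x = f y"
        using that f_simps(1) by (simp add: module_hom_minus[OF A S.module_axioms f] S.M.minus_eq_zero_iff)
      finally show ?thesis .
    qed
    define K where "K = q ` carrier A"
    \<comment> \<open>The map that \<open>f\<close> induces on \<open>K\<close>: pick any preimage
      under \<open>q\<close> and apply \<open>f\<close>; by \<open>q_eq_iff\<close> the choice does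
      not affect the value.\<close>
    define h where "h = (\<lambda>y. f (SOME x. x \<in> carrier A \<and> q x = y))"
    have h_q: "h (q x) = f x" if "x \<in> carrier A" for x
    proof -
      define z where "z = (SOME z. z \<in> carrier A \<and> q z = q x)"
      have "z \<in> carrier A \<and> q z = q x"
        unfolding z_def by (rule someI) (use that in simp)
      then show ?thesis
        using q_eq_iff[of z x] that by (simp add: h_def flip: z_def)
    qed
    have K: "submodule K R Q"
      unfolding K_def using submodule_image[OF A Q q A.carrier_is_submodule] .
    have K_module: "module R (Q\<lparr>carrier := K\<rparr>)"
      using submodule.submodule_is_module[OF K Q] .
    have h: "h \<in> module_hom R (Q\<lparr>carrier := K\<rparr>) S"
      by (rule module_homI)
        (auto simp: K_def h_q f_simps simp flip: q_simps(2,3))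
    \<comment> \<open>\<open>h\<close> embeds \<open>K\<close> into the reduced module
      \<open>S\<close>, so \<open>K\<close> is reduced and thus a legitimate domain for
      Red-injectivity.\<close>
    have "inj_on h (carrier (Q\<lparr>carrier := K\<rparr>))"
      by (auto simp: inj_on_def K_def h_q q_eq_iff)
    then have "semi_reduced_module R (Q\<lparr>carrier := K\<rparr>)"
      using reduced_module_embedding[OF K_module red h] reduced_imp_semi_reduced_module by blast
    then obtain g where g: "g \<in> module_hom R Q S" and g_h: "\<forall>y\<in>K. g y = h y"
      using inj Q K h unfolding strongly_Red_injective_def Red_injective_wrt_def by blast
    have "(\<lambda>x. g (p x)) \<in> module_hom R B S"
      using module_hom_compose[OF p g] .
    moreover have "g (p (i x)) = f x" if "x \<in> carrier A" for x
      using that g_h h_q by (simp add: K_def q_def)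
    ultimately show ?thesis by (intro bexI[of _ "\<lambda>x. g (p x)"] ballI)
  qed
  then show ?thesis
    unfolding injective_module_def using S.module_axioms by (intro conjI allI impI ballI) simp_all
qed

theorem theorem4:
  fixes R :: "('a, 'x) ring_scheme"
  assumes "cring R"
  shows "V_ring TYPE('s) TYPE('n) R \<longleftrightarrow>
    (\<forall>S :: ('a, 's) module. simple_module R S \<longrightarrow> strongly_Red_injective TYPE('n) R S)"
proof -
  \<comment> \<open>The two notions agree for each simple module separately, with the same test type
    \<open>'n\<close> on both sides.\<close>
  have "injective_module TYPE('n) R S \<longleftrightarrow> strongly_Red_injective TYPE('n) R S"
    if "simple_module R S" for S :: "('a, 's) module"
    using injective_imp_strongly_Red_injective[of R S]
      reduced_strongly_Red_injective_imp_injective[OF simple_imp_reduced_module[OF that]]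
    by (rule iffI)
  then show ?thesis
    using assms by (simp add: V_ring_def)
qed

end
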